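(* Let $\mathcal{K}=\{0,1\}$, $p\in[1,\infty)$, $L>0$, let $f:\mathcal{X}\to\mathcal{Y}$ be $L$-Lipschitz with respect to the $\ell_p$ norm, let $\gamma\in[0,1]$, and let $(X,Y)\in\mathcal{X}\times\mathcal{K}^{|\Omega|}$ be such that $S_1=\{\omega\in\Omega:Y_\omega=1\}$ is nonempty. Let $n_\gamma=\lceil\gamma|S_1|\rceil$ and $$R_\kappa(X,Y)=\inf\Big\{\epsilon\in\mathbb{R}^+\;:\;\exists\,\tilde X\in\mathcal{B}_p^{\epsilon}(X),\ \frac1{|S_1|}\sum_{\omega\in S_1}\mathbf{1}_{\tilde Y_\omega=Y_\omega}\le 1-\gamma\Big\},$$ where $\tilde Y_\omega=\arg\max_{k\in\mathcal{K}}f^k(\tilde X)_\omega$ (i.e. the least budget for which the false negative rate can reach at least $\gamma$). Then $$R_\kappa(X,Y)\;\ge\;\Big(\sum_{k=1}^{n_\gamma}R^{\pi_X(k)}(X,Y)^p\Big)^{1/p},$$ where $\pi_X:\{1,\dots,|S_1|\}\to S_1$ is a bijection sorting $S_1$ in ascending order of $R^\omega(X,Y)$.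
   Context: $\Omega$ is a finite nonempty set of coordinates (pixels), $\mathcal{X}=[0,1]^{|\Omega|}$, $\mathcal{Y}=\mathbb{R}^{|\mathcal{K}|\times|\Omega|}$ with the entrywise $\ell_p$ norm. A function $f:\mathcal{X}\to\mathcal{Y}$ is $L$-Lipschitz in $\ell_p$ norm if $\|f(X_1)-f(X_2)\|_p\le L\|X_1-X_2\|_p$ for all $X_1,X_2\in\mathcal{X}$. $f^k(X)_\omega$ is the output for class $k$ at coordinate $\omega$. $\mathcal{B}_p^{\epsilon}(X)=\{\tilde X\in\mathcal{X}:\|\tilde X-X\|_p\le\epsilon\}$, $\mathbb{R}^+=[0,\infty)$, $\inf\emptyset=+\infty$. The predicted class is $\hat Y_\omega=\arg\max_{k}f^k(X)_\omega$ (with any fixed tie-breaking rule). The margin $\mathcal{M}_X^\omega(f)=f^{\mathrm{top1}}(X)_\omega-f^{\mathrm{top2}}(X)_\omega\ge0$ is the difference between the largest and second largest (with multiplicity) of the values $f^k(X)_\omega$. The per-pixel robustness is $$R^\omega(X,Y)=\mathbf{1}_{\hat Y_\omega=Y_\omega}\cdot 2^{\frac{1-p}{p}}\cdot\mathcal{M}_X^\omega(f)/L .$$ *)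

theory Defs
  imports "HOL-Analysis.Analysis" "HOL-Library.Multiset"
begin

definition lp_norm :: "real \<Rightarrow> ('i::finite \<Rightarrow> real) \<Rightarrow> real" where
  "lp_norm p v = (\<Sum>i\<in>UNIV. \<bar>v i\<bar> powr p) powr (1 / p)"

definition unit_cube :: "(real ^ 'w) set" where
  "unit_cube = {x. \<forall>\<omega>. x $ \<omega> \<in> {0..1}}"

(* Outputs have type real ^ 'w ^ 'k, so that the score of class k at coordinate w is "f x $ k $ w";
   their norm is the entrywise one, over all pairs (k, w). *)
definition lp_lipschitz :: "real \<Rightarrow> real \<Rightarrow> (real ^ 'w \<Rightarrow> real ^ 'w ^ 'k) \<Rightarrow> bool" where
  "lp_lipschitz p L f \<longleftrightarrow> (\<forall>x1\<in>unit_cube. \<forall>x2\<in>unit_cube.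
     lp_norm p (\<lambda>(k, \<omega>). (f x1 - f x2) $ k $ \<omega>) \<le> L * lp_norm p (\<lambda>\<omega>. (x1 - x2) $ \<omega>))"

definition lp_ball :: "real \<Rightarrow> real \<Rightarrow> real ^ 'w \<Rightarrow> (real ^ 'w) set" where
  "lp_ball p \<epsilon> x = {x' \<in> unit_cube. lp_norm p (\<lambda>\<omega>. (x' - x) $ \<omega>) \<le> \<epsilon>}"

(* An arg max operator together with its tie-breaking rule: it maps every score vector to one of
   its maximizers. *)
definition argmax_rule :: "(('k \<Rightarrow> real) \<Rightarrow> 'k) \<Rightarrow> bool" where
  "argmax_rule am \<longleftrightarrow> (\<forall>v j. v j \<le> v (am v))"

definition prediction ::
    "(('k \<Rightarrow> real) \<Rightarrow> 'k) \<Rightarrow> (real ^ 'w \<Rightarrow> real ^ 'w ^ 'k) \<Rightarrow> real ^ 'w \<Rightarrow> 'k ^ 'w" where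
  "prediction am f x = (\<chi> \<omega>. am (\<lambda>k. f x $ k $ \<omega>))"

(* The multiset of values makes the second largest value count with multiplicity.
   Only meaningful for at least two classes. *)
definition top1 :: "('k::finite \<Rightarrow> real) \<Rightarrow> real" where
  "top1 v = Max_mset (image_mset v (mset_set UNIV))"

definition top2 :: "('k::finite \<Rightarrow> real) \<Rightarrow> real" where
  "top2 v = Max_mset (image_mset v (mset_set UNIV) - {#top1 v#})"

definition margin :: "(real ^ 'w \<Rightarrow> real ^ 'w ^ 'k) \<Rightarrow> real ^ 'w \<Rightarrow> 'w \<Rightarrow> real" where
  "margin f x \<omega> = top1 (\<lambda>k. f x $ k $ \<omega>) - top2 (\<lambda>k. f x $ k $ \<omega>)"

definition pixel_robustness ::
    "real \<Rightarrow> real \<Rightarrow> (('k \<Rightarrow> real) \<Rightarrow> 'k) \<Rightarrow> (real ^ 'w \<Rightarrow> real ^ 'w ^ 'k) \<Rightarrow>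
     real ^ 'w \<Rightarrow> 'k ^ 'w \<Rightarrow> 'w \<Rightarrow> real" where
  "pixel_robustness p L am f x y \<omega> =
     of_bool (prediction am f x $ \<omega> = y $ \<omega>) * 2 powr ((1 - p) / p) * margin f x \<omega> / L"

(* The two-element type 2 of HOL-Library.Numeral_Type plays the role of the class set {0, 1}. *)
definition positive_pixels :: "2 ^ 'w \<Rightarrow> 'w set" where
  "positive_pixels y = {\<omega>. y $ \<omega> = 1}"

(* Taken in the extended reals, where the infimum of the empty set is infinity. *)
definition fnr_robustness ::
    "real \<Rightarrow> real \<Rightarrow> ((2 \<Rightarrow> real) \<Rightarrow> 2) \<Rightarrow> (real ^ 'w \<Rightarrow> real ^ 'w ^ 2) \<Rightarrow>
     real ^ 'w \<Rightarrow> 2 ^ 'w \<Rightarrow> ereal" where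
  "fnr_robustness p \<gamma> am f x y =
     (INF \<epsilon> \<in> {\<epsilon>::real. 0 \<le> \<epsilon> \<and> (\<exists>x' \<in> lp_ball p \<epsilon> x.
        1 / real (card (positive_pixels y)) *
          (\<Sum>\<omega>\<in>positive_pixels y. of_bool (prediction am f x' $ \<omega> = y $ \<omega>)) \<le> 1 - \<gamma>)}.
      ereal \<epsilon>)"

end

theory Submission
  imports Defs
begin

text \<open>Take an admissible \<open>x'\<close> within distance \<open>\<epsilon>\<close> of
  \<open>X\<close>, and let \<open>W\<close> be the positive pixels that are misclassified at
  \<open>x'\<close>. At each pixel of \<open>W\<close> that was correct at \<open>X\<close>, the two
  class scores have crossed, so their changes add up to at least the margin; convexity of the p-th
  power turns this into a lower bound on the sum of the p-th powers of the two changes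
  (\<open>pixel_robustness_powr_le\<close>). Distinct pixels use disjoint output entries, so these
  bounds add up inside one \<open>lp_norm\<close>, which the Lipschitz condition controls by
  \<open>L * \<epsilon>\<close> (\<open>sum_pixel_robustness_powr_le\<close>). The false negative
  rate forces \<open>W\<close> to have at least as many elements as the rounded-up bound, and the
  cheapest set of that size consists of the first pixels in sorted order
  (\<open>sum_initial_le_sum_of_mono\<close>).\<close>

text \<open>Exchange argument: the common part of \<open>{1..n}\<close> and \<open>A\<close>
  cancels, and \<open>g n\<close> separates the values on the two remainders.\<close>

lemma sum_initial_le_sum_of_mono:
  fixes g :: "nat \<Rightarrow> real"
  assumes mono: "mono_on {1..N} g" and nonneg: "\<And>k. k \<in> {1..N} \<Longrightarrow> 0 \<le> g k"
    and A: "A \<subseteq> {1..N}" and n: "n \<le> card A"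
  shows "(\<Sum>k = 1..n. g k) \<le> (\<Sum>k\<in>A. g k)"
proof (cases "n = 0")
  case True
  then show ?thesis using nonneg A by (auto intro!: sum_nonneg)
next
  case False
  let ?B = "{1..n}"
  have finA: "finite A" using A finite_subset by blast
  have "card A \<le> N" using card_mono[OF _ A] by simp
  then have nN: "n \<in> {1..N}" using n False by auto
  \<comment> \<open>Both remainders lose the same intersection, so this is just
    \<open>n \<le> card A\<close>.\<close>
  have "card (?B - A) \<le> card (A - ?B)"
    using card_Diff_subset_Int[of ?B A] card_Diff_subset_Int[of A ?B] finA n
    by (simp add: Int_commute)
  have "(\<Sum>k\<in>?B - A. g k) \<le> real (card (?B - A)) * g n"
    by (rule sum_bounded_above) (use nN in \<open>auto intro!: mono_onD[OF mono]\<close>)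
  also have "\<dots> \<le> real (card (A - ?B)) * g n"
    using \<open>card (?B - A) \<le> card (A - ?B)\<close> nonneg[OF nN] by (intro mult_right_mono) auto
  also have "\<dots> \<le> (\<Sum>k\<in>A - ?B. g k)"
    by (rule sum_bounded_below) (use nN A in \<open>auto intro!: mono_onD[OF mono]\<close>)
  finally have "(\<Sum>k\<in>?B - A. g k) \<le> (\<Sum>k\<in>A - ?B. g k)" .
  then show ?thesis
    using sum.Int_Diff[of ?B g A] sum.Int_Diff[OF finA, of g ?B] by (simp add: Int_commute)
qed

text \<open>Midpoint convexity of the p-th power, scaled by \<open>2 powr p\<close>. This is where
  the factor \<open>2 powr ((1 - p) / p)\<close> in the robustness comes from.\<close>

lemma powr_add_le:
  fixes a b p :: real
  assumes p: "p \<ge> 1" and "0 \<le> a" and "0 \<le> b"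
  shows "(a + b) powr p \<le> 2 powr (p - 1) * (a powr p + b powr p)"
\<comment> \<open>Convexity is applied to positive arguments only; if one of them vanishes, the
  claim reduces to \<open>1 \<le> 2 powr (p - 1)\<close>.\<close>
proof (cases "a = 0 \<or> b = 0")
  case True
  have "1 \<le> 2 powr (p - 1)" using p by (simp add: ge_one_powr_ge_zero)
  then have "1 * c powr p \<le> 2 powr (p - 1) * c powr p" for c
    by (intro mult_right_mono) auto
  then show ?thesis using True by auto
next
  case False
  then have ab: "0 < a" "0 < b" using assms by auto
  have "((1/2) *\<^sub>R a + (1/2) *\<^sub>R b) powr p \<le> (1/2) * a powr p + (1/2) * b powr p"
    using convex_onD[OF powr_convex[OF p], of "1/2" a b] ab by simp
  then have "2 powr p * ((a + b) / 2) powr p \<le> 2 powr p * ((a powr p + b powr p) / 2)"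
    by (intro mult_left_mono) (auto simp: add_divide_distrib)
  moreover have "2 powr p * ((a + b) / 2) powr p = (a + b) powr p"
    using ab by (simp add: powr_divide)
  ultimately show ?thesis by (simp add: powr_diff)
qed

lemma UNIV_two_classes:
  fixes j k :: 2
  assumes "j \<noteq> k"
  shows "UNIV = {j, k}"
  using assms exhaust_2[of j] exhaust_2[of k] by (auto simp: UNIV_2)

text \<open>Removing one copy of the maximum from a two-element multiset leaves the minimum; in a
  tie both sides are 0.\<close>

lemma top1_minus_top2_two_classes:
  fixes v :: "2 \<Rightarrow> real"
  assumes "j \<noteq> k"
  shows "top1 v - top2 v = \<bar>v j - v k\<bar>"
proof -
  have "image_mset v (mset_set UNIV) = {#v j, v k#}"
    using assms by (simp add: UNIV_two_classes[OF assms])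
  then show ?thesis
    by (auto simp: top1_def top2_def max_def)
qed

lemma pixel_robustness_nonneg:
  fixes f :: "real ^ 'w \<Rightarrow> real ^ 'w ^ 2"
  assumes "L > 0"
  shows "pixel_robustness p L am f x y \<omega> \<ge> 0"
proof -
  have "margin f x \<omega> = \<bar>f x $ 1 $ \<omega> - f x $ 2 $ \<omega>\<bar>"
    unfolding margin_def by (rule top1_minus_top2_two_classes) simp
  then show ?thesis using assms by (simp add: pixel_robustness_def)
qed

text \<open>The estimate for a single pixel, kept in p-th powers so that it can be summed over
  pixels.\<close>

lemma pixel_robustness_powr_le:
  fixes f :: "real ^ 'w \<Rightarrow> real ^ 'w ^ 2"
  assumes p: "p \<ge> 1" and L: "L > 0" and am: "argmax_rule am"
    and wrong: "prediction am f x' $ \<omega> \<noteq> y $ \<omega>"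
  shows "L powr p * pixel_robustness p L am f x y \<omega> powr p
    \<le> (\<Sum>k\<in>UNIV. \<bar>(f x' - f x) $ k $ \<omega>\<bar> powr p)"
proof (cases "prediction am f x $ \<omega> = y $ \<omega>")
  \<comment> \<open>A pixel already wrong at \<open>x\<close> has robustness 0.\<close>
  case False
  then show ?thesis by (simp add: pixel_robustness_def sum_nonneg)
next
  case True
  define j where "j = y $ \<omega>"
  define k where "k = prediction am f x' $ \<omega>"
  define d where "d i = \<bar>(f x' - f x) $ i $ \<omega>\<bar>" for i
  have jk: "j \<noteq> k" using wrong by (simp add: j_def k_def)
  have am_max: "v i \<le> v (am v)" for v i using am by (simp only: argmax_rule_def)
  \<comment> \<open>The score difference of \<open>j\<close> over \<open>k\<close> is the margin at
    \<open>x\<close> and is not positive at \<open>x'\<close>, whatever the tie-breaking.\<close>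
  have "f x $ k $ \<omega> \<le> f x $ j $ \<omega>"
    using am_max[of "\<lambda>i. f x $ i $ \<omega>" k] True by (simp add: prediction_def j_def)
  moreover have "f x' $ j $ \<omega> \<le> f x' $ k $ \<omega>"
    using am_max[of "\<lambda>i. f x' $ i $ \<omega>" j] by (simp add: prediction_def k_def)
  ultimately have le: "margin f x \<omega> \<le> d j + d k"
    unfolding margin_def top1_minus_top2_two_classes[OF jk] d_def by simp
  have m0: "0 \<le> margin f x \<omega>"
    unfolding margin_def top1_minus_top2_two_classes[OF jk] by simp
  have "L powr p * pixel_robustness p L am f x y \<omega> powr p
      = 2 powr (1 - p) * margin f x \<omega> powr p"
    using True p L m0
    by (simp add: pixel_robustness_def powr_mult powr_divide powr_powr)
  also have "\<dots> \<le> 2 powr (1 - p) * (d j + d k) powr p"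
    using le m0 p by (intro mult_left_mono powr_mono2) auto
  also have "\<dots> \<le> 2 powr (1 - p) * (2 powr (p - 1) * (d j powr p + d k powr p))"
    using p by (intro mult_left_mono powr_add_le) (auto simp: d_def)
  \<comment> \<open>The constant of the robustness exactly cancels the convexity constant.\<close>
  also have "\<dots> = d j powr p + d k powr p"
    by (simp flip: powr_add mult.assoc)
  also have "\<dots> = (\<Sum>i\<in>UNIV. d i powr p)"
    using jk by (simp add: UNIV_two_classes[OF jk])
  finally show ?thesis by (simp add: d_def)
qed

lemma lp_norm_nonneg: "0 \<le> lp_norm p v"
  by (simp add: lp_norm_def)

lemma lp_norm_powr:
  assumes "p > 0"
  shows "lp_norm p v powr p = (\<Sum>i\<in>UNIV. \<bar>v i\<bar> powr p)"
  using assms by (simp add: lp_norm_def powr_powr sum_nonneg)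

text \<open>A wrong binary prediction at \<open>x'\<close> forces the two scores of that pixel to move by at
  least the margin in total, and distinct pixels use disjoint coordinates of the output.\<close>
lemma sum_pixel_robustness_powr_le:
  fixes f :: "real ^ 'w \<Rightarrow> real ^ 'w ^ 2"
  assumes p: "p \<ge> 1" and L: "L > 0" and am: "argmax_rule am" and lip: "lp_lipschitz p L f"
    and x: "x \<in> unit_cube" and x': "x' \<in> lp_ball p \<epsilon> x"
    and wrong: "\<And>\<omega>. \<omega> \<in> W \<Longrightarrow> prediction am f x' $ \<omega> \<noteq> y $ \<omega>"
  shows "(\<Sum>\<omega>\<in>W. pixel_robustness p L am f x y \<omega> powr p) \<le> \<epsilon> powr p"
proof -
  let ?d = "\<lambda>k \<omega>. \<bar>(f x' - f x) $ k $ \<omega>\<bar> powr p"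
  have x'1: "x' \<in> unit_cube" and x'2: "lp_norm p (\<lambda>\<omega>. (x' - x) $ \<omega>) \<le> \<epsilon>"
    using x' by (auto simp: lp_ball_def)
  have e0: "0 \<le> \<epsilon>" using x'2 lp_norm_nonneg order_trans by blast
  have "L powr p * (\<Sum>\<omega>\<in>W. pixel_robustness p L am f x y \<omega> powr p)
      \<le> (\<Sum>\<omega>\<in>W. \<Sum>k\<in>UNIV. ?d k \<omega>)"
    unfolding sum_distrib_left
    by (intro sum_mono pixel_robustness_powr_le[OF p L am wrong])
  also have "\<dots> \<le> (\<Sum>\<omega>\<in>UNIV. \<Sum>k\<in>UNIV. ?d k \<omega>)"
    by (intro sum_mono2) (auto intro!: sum_nonneg)
  also have "\<dots> = (\<Sum>k\<in>UNIV. \<Sum>\<omega>\<in>UNIV. ?d k \<omega>)"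
    by (rule sum.swap)
  also have "\<dots> = (\<Sum>(k, \<omega>)\<in>UNIV. ?d k \<omega>)"
    by (simp add: sum.cartesian_product)
  also have "\<dots> = lp_norm p (\<lambda>(k, \<omega>). (f x' - f x) $ k $ \<omega>) powr p"
    using p by (simp add: lp_norm_powr case_prod_beta)
  also have "\<dots> \<le> (L * lp_norm p (\<lambda>\<omega>. (x' - x) $ \<omega>)) powr p"
    using lip x x'1 p by (intro powr_mono2) (auto simp: lp_lipschitz_def lp_norm_nonneg)
  also have "\<dots> \<le> (L * \<epsilon>) powr p"
    using p L x'2 by (intro powr_mono2 mult_left_mono) (auto simp: lp_norm_nonneg)
  also have "\<dots> = L powr p * \<epsilon> powr p"
    using L e0 by (simp add: powr_mult)
  finally show ?thesis using L by simp
qed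

theorem mainTheorem5:
  fixes p L \<gamma> :: real
    and am :: "(2 \<Rightarrow> real) \<Rightarrow> 2"
    and f :: "real ^ 'w \<Rightarrow> real ^ 'w ^ 2"
    and X :: "real ^ 'w"
    and Y :: "2 ^ 'w"
    and \<pi> :: "nat \<Rightarrow> 'w"
  assumes "p \<ge> 1" and "L > 0"
    and "argmax_rule am"
    and "lp_lipschitz p L f"
    and "\<gamma> \<in> {0..1}"
    and "X \<in> unit_cube"
    and "positive_pixels Y \<noteq> {}"
    and "bij_betw \<pi> {1..card (positive_pixels Y)} (positive_pixels Y)"
    and "mono_on {1..card (positive_pixels Y)} (\<lambda>k. pixel_robustness p L am f X Y (\<pi> k))"
  shows "fnr_robustness p \<gamma> am f X Y \<ge>
    ereal ((\<Sum>k = 1..nat \<lceil>\<gamma> * real (card (positive_pixels Y))\<rceil>.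
              pixel_robustness p L am f X Y (\<pi> k) powr p) powr (1 / p))"
  unfolding fnr_robustness_def
\<comment> \<open>It suffices to bound every admissible budget from below; this also covers an
  infinite infimum.\<close>
proof (rule INF_greatest, unfold mem_Collect_eq ereal_less_eq, elim conjE bexE)
  fix \<epsilon> x'
  let ?S = "positive_pixels Y"
  let ?N = "card ?S"
  let ?n = "nat \<lceil>\<gamma> * real ?N\<rceil>"
  let ?R = "pixel_robustness p L am f X Y"
  assume e0: "0 \<le> \<epsilon>" and x': "x' \<in> lp_ball p \<epsilon> X"
    and acc: "1 / real ?N * (\<Sum>\<omega>\<in>?S. of_bool (prediction am f x' $ \<omega> = Y $ \<omega>)) \<le> 1 - \<gamma>"
  define C where "C = {\<omega> \<in> ?S. prediction am f x' $ \<omega> = Y $ \<omega>}"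
  define W where "W = ?S - C"
  define A where "A = {k \<in> {1..?N}. \<pi> k \<in> W}"
  have N: "?N > 0" using assms(7) by (simp add: card_gt_0_iff)
  have "(\<Sum>\<omega>\<in>?S. of_bool (prediction am f x' $ \<omega> = Y $ \<omega>)) = real (card C)"
    by (simp add: C_def Int_def)
  then have "real (card C) / real ?N \<le> 1 - \<gamma>"
    using acc by simp
  then have "real (card C) \<le> (1 - \<gamma>) * real ?N"
    using N by (simp add: pos_divide_le_eq)
  moreover have "card W = ?N - card C" "card C \<le> ?N"
    by (auto simp: W_def C_def intro!: card_Diff_subset card_mono)
  ultimately have "\<gamma> * real ?N \<le> real (card W)"
    by (simp add: of_nat_diff algebra_simps)
  \<comment> \<open>Since \<open>card W\<close> is an integer, the bound survives rounding
    up.\<close>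
  then have nW: "?n \<le> card W"
    by (simp add: nat_le_iff ceiling_le_iff)
  have "W \<subseteq> \<pi> ` {1..?N}"
    using bij_betw_imp_surj_on[OF assms(8)] by (simp add: W_def)
  then have "\<pi> ` A = W"
    unfolding A_def by blast
  then have bij: "bij_betw \<pi> A W"
    using assms(8) by (rule bij_betw_subset[rotated 2]) (auto simp: A_def)
  have R0: "0 \<le> ?R \<omega>" for \<omega> using assms(2) by (rule pixel_robustness_nonneg)
  have "(\<Sum>k = 1..?n. ?R (\<pi> k) powr p) \<le> (\<Sum>k\<in>A. ?R (\<pi> k) powr p)"
  proof (rule sum_initial_le_sum_of_mono)
    show "mono_on {1..?N} (\<lambda>k. ?R (\<pi> k) powr p)"
      using assms(1,9) R0 by (auto simp: mono_on_def intro!: powr_mono2)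
    show "?n \<le> card A" using nW bij_betw_same_card[OF bij] by simp
  qed (auto simp: A_def)
  also have "\<dots> = (\<Sum>\<omega>\<in>W. ?R \<omega> powr p)"
    by (rule sum.reindex_bij_betw[OF bij])
  also have "\<dots> \<le> \<epsilon> powr p"
    using assms(1-4,6) x' by (rule sum_pixel_robustness_powr_le) (auto simp: W_def C_def)
  finally have "(\<Sum>k = 1..?n. ?R (\<pi> k) powr p) powr (1 / p) \<le> (\<epsilon> powr p) powr (1 / p)"
    using assms(1) by (intro powr_mono2) (auto intro!: sum_nonneg)
  also have "\<dots> = \<epsilon>" using assms(1) e0 by (simp add: powr_powr)
  finally show "(\<Sum>k = 1..?n. ?R (\<pi> k) powr p) powr (1 / p) \<le> \<epsilon>" .
qed

end
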